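(* Suppose that both the UL property with IA and the LL property with IA hold. For each $K\ge 1$, let $(\mathbf{x}_K,\mathbf{z}_K)\in\mathcal{X}\times\mathcal{Z}$ be a minimizer of $\psi_K$ over $\mathcal{X}\times\mathcal{Z}$, i.e. $$\psi_K(\mathbf{x}_K,\mathbf{z}_K)\le \psi_K(\mathbf{x},\mathbf{z}),\qquad \forall\, \mathbf{x}\in\mathcal{X},\ \mathbf{z}\in\mathcal{Z}.$$ Then any limit point $\bar{\mathbf{x}}$ of the sequence $\{\mathbf{x}_K\}$ satisfies $\bar{\mathbf{x}}\in\arg\min_{\mathbf{x}\in\mathcal{X}}\varphi(\mathbf{x})$, i.e. $\bar{\mathbf{x}}$ solves the bilevel problem $\min_{\mathbf{x}\in\mathcal{X}}\varphi(\mathbf{x})$.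
   Context: Setting. $\mathcal{X}\subset\mathbb{R}^m$, $\mathcal{Y}\subset\mathbb{R}^n$, $\mathcal{Z}\subset\mathbb{R}^n$; $F,f$ are real-valued functions of $(\mathbf{x},\mathbf{y})$ (upper-level and lower-level objectives) and $g:\mathbb{R}^n\to\mathbb{R}$. Put $$\mathcal{S}(\mathbf{x}):=\arg\min_{\mathbf{y}\in\mathcal{Y}} f(\mathbf{x},\mathbf{y}),\quad f^*(\mathbf{x}):=\min_{\mathbf{y}\in\mathcal{Y}} f(\mathbf{x},\mathbf{y}),\quad \varphi(\mathbf{x}):=\inf_{\mathbf{y}\in\mathcal{S}(\mathbf{x})}F(\mathbf{x},\mathbf{y})\qquad(\mathbf{x}\in\mathcal{X}).$$ Standing assumptions: (1) $F,\nabla_{\mathbf{y}}F,f,\nabla_{\mathbf{y}}f$ are continuous on $\mathcal{X}\times\mathbb{R}^n$. (2) For every $\mathbf{x}\in\mathcal{X}$, $F(\mathbf{x},\cdot):\mathbb{R}^n\to\mathbb{R}$ is $L_F$-smooth (gradient $L_F$-Lipschitz), convex and bounded below by $M_0$ ($L_F,M_0$ independent of $\mathbf{x}$). (3) For every $\mathbf{x}\in\mathcal{X}$, $f(\mathbf{x},\cdot):\mathbb{R}^n\to\mathbb{R}$ is $L_f$-smooth and convex ($L_f$ independent of $\mathbf{x}$), and $f(\mathbf{x},\mathbf{y})$ is level-bounded in $\mathbf{y}$ uniformly in $\mathbf{x}\in\mathcal{X}$ (for each $c\in\mathbb{R}$ there is a bounded set containing $\{\mathbf{y}: f(\mathbf{x},\mathbf{y})\le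 c\}$ for all $\mathbf{x}\in\mathcal{X}$). (4) $\mathcal{X},\mathcal{Y},\mathcal{Z}$ are compact and $\mathcal{Y}$ is convex. (5) $\hat{\mathcal{S}}(\mathbf{x}):=\arg\min_{\mathbf{y}}\{F(\mathbf{x},\mathbf{y}):\mathbf{y}\in\mathcal{Y}\cap\mathcal{S}(\mathbf{x})\}$ is nonempty for all $\mathbf{x}\in\mathcal{X}$. (6) $g$ is continuous on $\mathcal{Z}$. Iterates. For given maps $\mathcal{T}_{k+1}(\mathbf{x},\cdot):\mathbb{R}^n\to\mathcal{Y}$ ($k\ge0$, $\mathbf{x}\in\mathcal{X}$), define for $(\mathbf{x},\mathbf{z})\in\mathcal{X}\times\mathcal{Z}$ $$\mathbf{y}_0(\mathbf{x},\mathbf{z})=\mathbf{z},\qquad \mathbf{y}_{k+1}(\mathbf{x},\mathbf{z})=\mathcal{T}_{k+1}(\mathbf{x},\mathbf{y}_k(\mathbf{x},\mathbf{z})),$$ and set $\varphi_K(\mathbf{x},\mathbf{z}):=F(\mathbf{x},\mathbf{y}_K(\mathbf{x},\mathbf{z}))$ and $\psi_K(\mathbf{x},\mathbf{z}):=\varphi_K(\mathbf{x},\mathbf{z})+g(\mathbf{z})$. UL property with IA: for each $\mathbf{x}\in\mathcal{X}$ and $\mathbf{z}\in\mathcal{Z}$, $\lim_{K\to\infty}\varphi_K(\mathbf{x},\mathbf{z})=\varphi(\mathbf{x})$. LL property with IA: $\{\mathbf{y}_K(\mathbf{x},\mathbf{z})\}$ is uniformly bounded on $\mathcal{X}\times\mathcal{Z}$,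 and for any $\epsilon>0$ there exists $k(\epsilon)>0$ such that whenever $K>k(\epsilon)$, $\sup_{\mathbf{x}\in\mathcal{X},\mathbf{z}\in\mathcal{Z}}\{f(\mathbf{x},\mathbf{y}_K(\mathbf{x},\mathbf{z}))-f^*(\mathbf{x})\}\le\epsilon$. *)

theory Defs
  imports "HOL-Analysis.Analysis"
begin

definition argmin_set :: "('a \<Rightarrow> real) \<Rightarrow> 'a set \<Rightarrow> 'a set" where
  "argmin_set h A = {y. is_arg_min h (\<lambda>u. u \<in> A) y}"

definition grad :: "('a::real_inner \<Rightarrow> real) \<Rightarrow> 'a \<Rightarrow> 'a" where
  "grad h y = (THE D. GDERIV h y :> D)"

lemma grad_eq:
  assumes "GDERIV h y :> D"
  shows "grad h y = D"
proof -
  have "E = D" if "GDERIV h y :> E" for E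
  proof -
    have "(\<lambda>u. inner u E) = (\<lambda>u. inner u D)"
      using that assms unfolding gderiv_def by (rule has_derivative_unique)
    then have "inner (E - D) E = inner (E - D) D" by meson
    then have "inner (E - D) (E - D) = 0" by (simp add: inner_diff_right)
    then show ?thesis by simp
  qed
  with assms show ?thesis unfolding grad_def by blast
qed

definition L_smooth :: "real \<Rightarrow> ('a::euclidean_space \<Rightarrow> real) \<Rightarrow> bool" where
  "L_smooth L h \<longleftrightarrow> (\<forall>y. h differentiable (at y)) \<and> L-lipschitz_on UNIV (grad h)"

definition unif_level_bounded :: "'a set \<Rightarrow> ('a \<Rightarrow> 'b::metric_space \<Rightarrow> real) \<Rightarrow> bool" where
  "unif_level_bounded X f \<longleftrightarrow>
     (\<forall>c. \<exists>B. bounded B \<and> (\<forall>x\<in>X. {y. f x y \<le> c} \<subseteq> B))"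

definition LL_sol :: "('a \<Rightarrow> 'b \<Rightarrow> real) \<Rightarrow> 'b set \<Rightarrow> 'a \<Rightarrow> 'b set" where
  "LL_sol f Y x = argmin_set (f x) Y"

(* The infimum is a minimum whenever Y is compact and nonempty and f x is continuous. *)
definition LL_val :: "('a \<Rightarrow> 'b \<Rightarrow> real) \<Rightarrow> 'b set \<Rightarrow> 'a \<Rightarrow> real" where
  "LL_val f Y x = (INF y\<in>Y. f x y)"

(* A real infimum: meaningful when LL_sol f Y x is nonempty and F x is bounded below. *)
definition phi :: "('a \<Rightarrow> 'b \<Rightarrow> real) \<Rightarrow> ('a \<Rightarrow> 'b \<Rightarrow> real) \<Rightarrow> 'b set \<Rightarrow> 'a \<Rightarrow> real" where
  "phi F f Y x = (INF y\<in>LL_sol f Y x. F x y)"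

definition S_hat :: "('a \<Rightarrow> 'b \<Rightarrow> real) \<Rightarrow> ('a \<Rightarrow> 'b \<Rightarrow> real) \<Rightarrow> 'b set \<Rightarrow> 'a \<Rightarrow> 'b set" where
  "S_hat F f Y x = argmin_set (F x) (Y \<inter> LL_sol f Y x)"

(* The value T 0 is never used; the maps are T 1, T 2, ... *)
primrec iter_y :: "(nat \<Rightarrow> 'a \<Rightarrow> 'b \<Rightarrow> 'b) \<Rightarrow> nat \<Rightarrow> 'a \<Rightarrow> 'b \<Rightarrow> 'b" where
  "iter_y T 0 x z = z"
| "iter_y T (Suc k) x z = T (Suc k) x (iter_y T k x z)"

definition phi_K ::
  "('a \<Rightarrow> 'b \<Rightarrow> real) \<Rightarrow> (nat \<Rightarrow> 'a \<Rightarrow> 'b \<Rightarrow> 'b) \<Rightarrow> nat \<Rightarrow> 'a \<Rightarrow> 'b \<Rightarrow> real" where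
  "phi_K F T K x z = F x (iter_y T K x z)"

definition psi_K ::
  "('a \<Rightarrow> 'b \<Rightarrow> real) \<Rightarrow> ('b \<Rightarrow> real) \<Rightarrow> (nat \<Rightarrow> 'a \<Rightarrow> 'b \<Rightarrow> 'b) \<Rightarrow> nat \<Rightarrow> 'a \<Rightarrow> 'b \<Rightarrow> real" where
  "psi_K F g T K x z = phi_K F T K x z + g z"

definition UL_property_IA ::
  "('a \<Rightarrow> 'b \<Rightarrow> real) \<Rightarrow> ('a \<Rightarrow> 'b \<Rightarrow> real) \<Rightarrow> (nat \<Rightarrow> 'a \<Rightarrow> 'b \<Rightarrow> 'b)
     \<Rightarrow> 'a set \<Rightarrow> 'b set \<Rightarrow> 'b set \<Rightarrow> bool" where
  "UL_property_IA F f T X Y Z \<longleftrightarrow>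
     (\<forall>x\<in>X. \<forall>z\<in>Z. (\<lambda>K. phi_K F T K x z) \<longlonglongrightarrow> phi F f Y x)"

(* The supremum is taken in the extended reals, so that bounding it by \<epsilon> includes
   the claim that it is finite. *)
definition LL_property_IA ::
  "('a \<Rightarrow> 'b::metric_space \<Rightarrow> real) \<Rightarrow> (nat \<Rightarrow> 'a \<Rightarrow> 'b \<Rightarrow> 'b)
     \<Rightarrow> 'a set \<Rightarrow> 'b set \<Rightarrow> 'b set \<Rightarrow> bool" where
  "LL_property_IA f T X Y Z \<longleftrightarrow>
     bounded {iter_y T K x z | K x z. x \<in> X \<and> z \<in> Z} \<and>
     (\<forall>\<epsilon>>0. \<exists>k>0. \<forall>K>k.
        (SUP (x, z)\<in>X \<times> Z. ereal (f x (iter_y T K x z) - LL_val f Y x)) \<le> ereal \<epsilon>)"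

end

theory Submission
  imports Defs
begin

text \<open>
  The argument is by compactness. Extract from the minimizers \<open>(x\<^sub>K, z\<^sub>K)\<close> and the iterates
  \<open>y\<^sub>K = y\<^sub>K(x\<^sub>K, z\<^sub>K)\<close>, which lie in \<open>Y\<close> for \<open>K \<ge> 1\<close>, a common subsequence converging to
  \<open>(xbar, zbar, ybar)\<close>. Two facts about the limit decide everything.

  First, the gap \<open>f x y\<^sub>K - f\<^sup>* x\<close> vanishes uniformly in \<open>x\<close>, so it vanishes along the moving
  points \<open>x\<^sub>K\<close>; since \<open>f\<close> is jointly continuous, \<open>ybar\<close> solves the lower-level problem at
  \<open>xbar\<close> (lemma \<open>limit_of_iterates_in_LL_sol\<close>). Hence \<open>phi xbar \<le> F xbar ybar\<close>.

  Second, fix \<open>x \<in> X\<close> and compare \<open>(x\<^sub>K, z\<^sub>K)\<close> with the single competitor \<open>(x, zbar)\<close>. Letting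
  \<open>K\<close> grow, with joint continuity on the left and the pointwise upper-level property on the right,
  gives \<open>F xbar ybar + g zbar \<le> phi x + g zbar\<close>. The choice \<open>z = zbar\<close> makes the two values of
  \<open>g\<close> cancel, and \<open>phi xbar \<le> phi x\<close> follows.
\<close>

lemma mem_argmin_set_iff:
  "y \<in> argmin_set h A \<longleftrightarrow> y \<in> A \<and> (\<forall>u\<in>A. h y \<le> h u)"
  by (auto simp: argmin_set_def is_arg_min_linorder)

lemma phi_le:
  assumes "\<And>u. M \<le> F x u" and "y \<in> LL_sol f Y x"
  shows "phi F f Y x \<le> F x y"
  unfolding phi_def using assms by (intro cINF_lower bdd_belowI2[where m = M])

lemma LL_val_le:
  fixes f :: "'a \<Rightarrow> 'b::topological_space \<Rightarrow> real"
  assumes "compact Y" and "continuous_on Y (f x)" and "y \<in> Y"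
  shows "LL_val f Y x \<le> f x y"
  unfolding LL_val_def using assms
  by (intro cINF_lower bounded_imp_bdd_below compact_imp_bounded compact_continuous_image)

lemma LL_property_IA_gap:
  assumes "LL_property_IA f T X Y Z" and "\<epsilon> > 0"
  shows "\<forall>\<^sub>F K in sequentially. \<forall>x\<in>X. \<forall>z\<in>Z. f x (iter_y T K x z) \<le> LL_val f Y x + \<epsilon>"
proof -
  obtain k where k: "\<And>K. K > k \<Longrightarrow>
      (SUP (x, z)\<in>X \<times> Z. ereal (f x (iter_y T K x z) - LL_val f Y x)) \<le> ereal \<epsilon>"
    using assms unfolding LL_property_IA_def by blast
  have "\<forall>x\<in>X. \<forall>z\<in>Z. f x (iter_y T K x z) \<le> LL_val f Y x + \<epsilon>" if "K > k" for K
    using k[OF that] by (auto simp: SUP_le_iff algebra_simps)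
  then show ?thesis
    by (auto intro: eventually_mono[OF eventually_gt_at_top[of k]])
qed

lemma tendsto_along_continuous_on_product:
  assumes "continuous_on (X \<times> UNIV) (\<lambda>(x, y). h x y)"
    and "x \<longlonglongrightarrow> a" and "y \<longlonglongrightarrow> b" and "\<And>j. x j \<in> X" and "a \<in> X"
  shows "(\<lambda>j. h (x j) (y j)) \<longlonglongrightarrow> h a b"
proof -
  have "(\<lambda>j. (\<lambda>(x, y). h x y) (x j, y j)) \<longlonglongrightarrow> (\<lambda>(x, y). h x y) (a, b)"
    using assms by (intro continuous_on_tendsto_compose[OF assms(1)] tendsto_Pair) auto
  then show ?thesis by simp
qed

text \<open>
  The base point \<open>x j\<close> and the iteration number \<open>K j\<close> change together, which is why the
  lower-level gap must vanish uniformly over \<open>X \<times> Z\<close>. The iterate is compared with one fixed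
  \<open>u \<in> Y\<close>, through \<open>LL_val f Y (x j) \<le> f (x j) u\<close>, so that the limit is taken in two values
  of the continuous function \<open>f\<close> and not in the optimal value.
\<close>
lemma limit_of_iterates_in_LL_sol:
  fixes f :: "'a::metric_space \<Rightarrow> 'b::metric_space \<Rightarrow> real"
  assumes f_cont: "continuous_on (X \<times> UNIV) (\<lambda>(x, y). f x y)"
    and Y: "compact Y"
    and LL: "LL_property_IA f T X Y Z"
    and K: "filterlim K at_top sequentially"
    and mem: "\<And>j. x j \<in> X" "\<And>j. z j \<in> Z" "a \<in> X" "b \<in> Y"
    and x: "x \<longlonglongrightarrow> a"
    and y: "(\<lambda>j. iter_y T (K j) (x j) (z j)) \<longlonglongrightarrow> b"
  shows "b \<in> LL_sol f Y a"
proof -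
  have "f a b \<le> f a u" if u: "u \<in> Y" for u
  proof (rule field_le_epsilon)
    fix \<epsilon> :: real assume "\<epsilon> > 0"
    have val: "LL_val f Y (x j) \<le> f (x j) u" for j
    proof (rule LL_val_le[OF Y _ u])
      have "continuous_on Y (\<lambda>v. (\<lambda>(x, y). f x y) (x j, v))"
        using mem by (intro continuous_on_compose2[OF f_cont] continuous_intros) auto
      then show "continuous_on Y (f (x j))" by simp
    qed
    have "\<forall>\<^sub>F j in sequentially. f (x j) (iter_y T (K j) (x j) (z j)) \<le> f (x j) u + \<epsilon>"
      using eventually_compose_filterlim[OF LL_property_IA_gap[OF LL \<open>\<epsilon> > 0\<close>] K]
    proof eventually_elim
      case (elim j)
      then have "f (x j) (iter_y T (K j) (x j) (z j)) \<le> LL_val f Y (x j) + \<epsilon>"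
        using mem(1,2)[of j] by blast
      with val[of j] show ?case by linarith
    qed
    moreover have "(\<lambda>j. f (x j) (iter_y T (K j) (x j) (z j))) \<longlonglongrightarrow> f a b"
      using mem by (intro tendsto_along_continuous_on_product[OF f_cont x y]) auto
    moreover have "(\<lambda>j. f (x j) u + \<epsilon>) \<longlonglongrightarrow> f a u + \<epsilon>"
      using mem
      by (intro tendsto_add tendsto_const tendsto_along_continuous_on_product[OF f_cont x]) auto
    ultimately show "f a b \<le> f a u + \<epsilon>"
      by (intro tendsto_le[OF sequentially_bot])
  qed
  then show ?thesis using mem by (simp add: LL_sol_def mem_argmin_set_iff)
qed

theorem theorem4p1:
  fixes X :: "(real ^ 'm) set"
    and Y Z :: "(real ^ 'n) set"
    and F f :: "real ^ 'm \<Rightarrow> real ^ 'n \<Rightarrow> real"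
    and g :: "real ^ 'n \<Rightarrow> real"
    and T :: "nat \<Rightarrow> real ^ 'm \<Rightarrow> real ^ 'n \<Rightarrow> real ^ 'n"
    and L\<^sub>F L\<^sub>f M\<^sub>0 :: real
    and xs :: "nat \<Rightarrow> real ^ 'm" and zs :: "nat \<Rightarrow> real ^ 'n"
    and xbar :: "real ^ 'm"
  assumes F_cont: "continuous_on (X \<times> UNIV) (\<lambda>(x, y). F x y)"
    and gradF_cont: "continuous_on (X \<times> UNIV) (\<lambda>(x, y). grad (F x) y)"
    and f_cont: "continuous_on (X \<times> UNIV) (\<lambda>(x, y). f x y)"
    and gradf_cont: "continuous_on (X \<times> UNIV) (\<lambda>(x, y). grad (f x) y)"
    and F_smooth: "\<And>x. x \<in> X \<Longrightarrow> L_smooth L\<^sub>F (F x)"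
    and F_convex: "\<And>x. x \<in> X \<Longrightarrow> convex_on UNIV (F x)"
    and F_bdd_below: "\<And>x y. x \<in> X \<Longrightarrow> M\<^sub>0 \<le> F x y"
    and f_smooth: "\<And>x. x \<in> X \<Longrightarrow> L_smooth L\<^sub>f (f x)"
    and f_convex: "\<And>x. x \<in> X \<Longrightarrow> convex_on UNIV (f x)"
    and f_level_bounded: "unif_level_bounded X f"
    and compact_sets: "compact X" "compact Y" "compact Z"
    and Y_convex: "convex Y"
    and S_hat_nonempty: "\<And>x. x \<in> X \<Longrightarrow> S_hat F f Y x \<noteq> {}"
    and g_cont: "continuous_on Z g"
    and T_into_Y: "\<And>k x y. x \<in> X \<Longrightarrow> T (Suc k) x y \<in> Y"
    and UL: "UL_property_IA F f T X Y Z"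
    and LL: "LL_property_IA f T X Y Z"
    and xz_mem: "\<And>K. K \<ge> 1 \<Longrightarrow> xs K \<in> X \<and> zs K \<in> Z"
    and xz_min: "\<And>K x z. K \<ge> 1 \<Longrightarrow> x \<in> X \<Longrightarrow> z \<in> Z \<Longrightarrow>
                   psi_K F g T K (xs K) (zs K) \<le> psi_K F g T K x z"
    and limit_point: "\<exists>r :: nat \<Rightarrow> nat. strict_mono r \<and> (xs \<circ> r) \<longlonglongrightarrow> xbar"
  shows "xbar \<in> argmin_set (phi F f Y) X"
proof -
  obtain r where r: "strict_mono r" "(xs \<circ> r) \<longlonglongrightarrow> xbar"
    using limit_point by blast
  define y where "y K = iter_y T K (xs K) (zs K)" for K
  have y_mem: "y K \<in> Y" if "K \<ge> 1" for K
    using that xz_mem[OF that] T_into_Y by (cases K) (auto simp: y_def)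

  (* Nothing is known about xs 0 and zs 0, and y 0 = zs 0 need not lie in Y; passing to
     r (Suc j), which is at least 1, avoids that index. *)
  define r' where "r' j = r (Suc j)" for j
  have r'_mono: "strict_mono r'"
    using r(1) by (auto simp: r'_def strict_mono_def)
  have r'_ge: "r' j \<ge> 1" for j
    using strict_mono_imp_increasing[OF r(1), of "Suc j"] by (simp add: r'_def)
  have "compact (Z \<times> Y)" using compact_sets by (intro compact_Times)
  moreover have "\<forall>j. (zs (r' j), y (r' j)) \<in> Z \<times> Y"
    using xz_mem y_mem r'_ge by blast
  ultimately obtain l s where l: "l \<in> Z \<times> Y" and s: "strict_mono s"
      and lim: "((\<lambda>j. (zs (r' j), y (r' j))) \<circ> s) \<longlonglongrightarrow> l"
    unfolding compact_def by meson
  obtain zbar ybar where l_eq: "l = (zbar, ybar)" by (cases l)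
  define K where "K j = r' (s j)" for j
  have K_ge: "K j \<ge> 1" for j unfolding K_def by (rule r'_ge)
  have mem: "xs (K j) \<in> X" "zs (K j) \<in> Z" for j using xz_mem[OF K_ge] by auto
  have K_lim: "filterlim K at_top sequentially"
    using filterlim_subseq[OF strict_mono_o[OF r'_mono s]] by (simp add: K_def[abs_def] o_def)
  have z_lim: "(\<lambda>j. zs (K j)) \<longlonglongrightarrow> zbar" and y_lim: "(\<lambda>j. y (K j)) \<longlonglongrightarrow> ybar"
    using tendsto_fst[OF lim] tendsto_snd[OF lim] by (simp_all add: l_eq o_def K_def)
  have x_lim: "(\<lambda>j. xs (K j)) \<longlonglongrightarrow> xbar"
    using LIMSEQ_subseq_LIMSEQ[OF LIMSEQ_Suc[OF r(2)] s] by (simp add: o_def K_def r'_def)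
  have bars: "zbar \<in> Z" "ybar \<in> Y" using l by (auto simp: l_eq)
  have xbar: "xbar \<in> X"
    using closed_sequentially[OF compact_imp_closed[OF compact_sets(1)] _ x_lim] mem by blast

  have "ybar \<in> LL_sol f Y xbar"
    using limit_of_iterates_in_LL_sol[OF f_cont compact_sets(2) LL K_lim mem xbar bars(2) x_lim]
      y_lim by (simp add: y_def)
  then have phi_xbar: "phi F f Y xbar \<le> F xbar ybar"
    using F_bdd_below[OF xbar] by (intro phi_le[where M = M\<^sub>0]) auto

  have "phi F f Y xbar \<le> phi F f Y x" if x: "x \<in> X" for x
  proof -
    have "(\<lambda>j. F (xs (K j)) (y (K j)) + g (zs (K j))) \<longlonglongrightarrow> F xbar ybar + g zbar"
      using mem xbar bars
      by (intro tendsto_add tendsto_along_continuous_on_product[OF F_cont x_lim y_lim]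
          continuous_on_tendsto_compose[OF g_cont z_lim]) auto
    moreover have "(\<lambda>j. phi_K F T (K j) x zbar + g zbar) \<longlonglongrightarrow> phi F f Y x + g zbar"
      using UL x bars unfolding UL_property_IA_def
      by (intro tendsto_add tendsto_const filterlim_compose[OF _ K_lim]) blast
    moreover have "F (xs (K j)) (y (K j)) + g (zs (K j)) \<le> phi_K F T (K j) x zbar + g zbar" for j
      using xz_min[OF K_ge x bars(1), of j] by (simp add: psi_K_def phi_K_def y_def)
    ultimately have "F xbar ybar + g zbar \<le> phi F f Y x + g zbar"
      by (intro LIMSEQ_le) auto
    with phi_xbar show ?thesis by simp
  qed
  with xbar show ?thesis by (simp add: mem_argmin_set_iff)
qed

end
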